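(* According to relative worst order analysis, $\mathrm{WR}_{\mathrm{Nai},\mathrm{Eag}}=\frac n2$.
   Context: Online frequent items problem: an input sequence is $I=a_1,\ldots,a_n$ of items from an infinite universe, $n=|I|$. An algorithm maintains a buffer holding one item; $s_t$ is the buffer content after step $t$; at step $1$ the buffer receives $a_1$, and at each later step $t$ the algorithm either keeps $s_{t-1}$ or replaces it by $a_t$. With $f_I(a)=|\{i:a_i=a\}|/n$, the aggregate frequency of $\mathcal A$ on $I$ is $\mathcal A(I)=\sum_{t=1}^n f_I(s^{\mathcal A}_t)$ (to be maximized). Nai sets $s_t=a_t$ for all $t$. Eag: let $t^*=\min\{t\in\{1,\ldots,n-1\}: a_t=a_{t+1}\}$ if such $t$ exists, else $t^*=n$; Eag sets $s_t=a_t$ for $t\le t^*$ and $s_t=a_{t^*}$ for $t>t^*$. For an algorithm $\mathcal A$, $\mathcal A_W(I)=\min_\sigma\mathcal A(\sigma(I))$ over all permutations $\sigma(I)$ of $I$. Relative worst order analysis: for a total order $\sqsubseteq\in\{\le,\ge\}$, $f$ is an $(\mathcal A,\mathcal B,\sqsubseteq)$-function if there is $h\in o(f)$ such that for all $I$ (with $n=|I|$), $\mathcal A_W(I)\sqsubseteq (f(n)+h(n))\,\mathcal B_W(I)$. $f$ is a bounding function with respect to $(\mathcal A,\mathcal B,\sqsubseteq)$ if it is an $(\mathcal A,\mathcal B,\sqsubseteq)$-function and for every $(\mathcal A,\mathcal B,\sqsubseteq)$-function $g$, $\lim_{n\to\infty} f(n)/g(n)\sqsubseteq 1$. Let $f$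 be a bounding function w.r.t. $(\mathcal A,\mathcal B,\le)$ and $g$ one w.r.t. $(\mathcal A,\mathcal B,\ge)$. $\mathcal A$ and $\mathcal B$ are comparable if $\lim f(n)\le 1$ or $\lim g(n)\ge1$. If $\lim f(n)\le1$, then $\mathcal B$ is better than $\mathcal A$ and $g$ is a relative worst order function of $\mathcal A$ and $\mathcal B$; if $\lim g(n)\ge 1$, then $\mathcal A$ is better than $\mathcal B$ and $f$ is a relative worst order function of $\mathcal A$ and $\mathcal B$. Functions $f,g$ are equivalent if $\lim f(n)/g(n)=1$; $\mathrm{WR}_{\mathcal A,\mathcal B}=f(n)$ means $f$ lies in the equivalence class of relative worst order functions of $\mathcal A$ and $\mathcal B$. *)

theory Defs
  imports
    Complex_Main
    "HOL-Library.Landau_Symbols"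
    "HOL-Library.Extended_Real"
    "HOL-Library.Liminf_Limsup"
    "HOL-Combinatorics.Multiset_Permutations"
begin

text \<open>
  An algorithm is represented by the buffer contents it produces: \<open>A I t\<close> is the content
  \<open>s\<^sub>t\<close> after step \<open>t\<close> on input \<open>I\<close>, for \<open>1 \<le> t \<le> length I\<close>; other values of \<open>t\<close> are irrelevant.
\<close>

type_synonym 'a algorithm = "'a list \<Rightarrow> nat \<Rightarrow> 'a"

text \<open>Steps are numbered from 1, whereas lists are indexed from 0.\<close>

definition item :: "'a list \<Rightarrow> nat \<Rightarrow> 'a" where
  "item I t = I ! (t - 1)"

definition nai :: "'a algorithm" where
  "nai I t = item I t"

definition eag_stop :: "'a list \<Rightarrow> nat" where
  "eag_stop I =
     (let T = {t \<in> {1..<length I}. item I t = item I (t + 1)}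
      in if T = {} then length I else Min T)"

definition eag :: "'a algorithm" where
  "eag I t = (if t \<le> eag_stop I then item I t else item I (eag_stop I))"

definition freq :: "'a list \<Rightarrow> 'a \<Rightarrow> real" where
  "freq I a = real (card {i \<in> {1..length I}. item I i = a}) / real (length I)"

definition aggregate :: "'a algorithm \<Rightarrow> 'a list \<Rightarrow> real" where
  "aggregate A I = (\<Sum>t = 1..length I. freq I (A I t))"

definition worst_order :: "'a algorithm \<Rightarrow> 'a list \<Rightarrow> real" where
  "worst_order A I = Min (aggregate A ` permutations_of_multiset (mset I))"

text \<open>The two total orders \<open>\<le>\<close> and \<open>\<ge>\<close>, to be used both on \<open>real\<close> and on \<open>ereal\<close>.\<close>

datatype direction = Le | Ge

fun cmp :: "direction \<Rightarrow> 'a::linorder \<Rightarrow> 'a \<Rightarrow> bool" where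
  "cmp Le x y \<longleftrightarrow> x \<le> y"
| "cmp Ge x y \<longleftrightarrow> x \<ge> y"

text \<open>
  Ratio functions map positive integers to positive reals (the value at 0 is irrelevant).
  Without positivity every negative function would be a function for the direction \<open>\<ge>\<close>.
  The error term \<open>h\<close> may have any sign.
\<close>

definition rel_function ::
    "'a algorithm \<Rightarrow> 'a algorithm \<Rightarrow> direction \<Rightarrow> (nat \<Rightarrow> real) \<Rightarrow> bool" where
  "rel_function A B d f \<longleftrightarrow>
     (\<forall>n\<ge>1. f n > 0) \<and>
     (\<exists>h. h \<in> o(f) \<and>
        (\<forall>I. I \<noteq> [] \<longrightarrow>
           cmp d (worst_order A I) ((f (length I) + h (length I)) * worst_order B I)))"

text \<open>
  In the definition of bounding functions, the competing function \<open>g\<close> is arbitrary, so the quotient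
  \<open>f n / g n\<close> need not converge (multiplying \<open>g\<close> by 2 on all odd \<open>n\<close> gives
  another function for the direction \<open>\<le>\<close>). The requirement \<open>lim f n / g n \<le> 1\<close> is therefore
  read with the limit superior and \<open>lim f n / g n \<ge> 1\<close> with the limit inferior.
\<close>

fun asymp_cmp :: "direction \<Rightarrow> (nat \<Rightarrow> real) \<Rightarrow> ereal \<Rightarrow> bool" where
  "asymp_cmp Le \<phi> c \<longleftrightarrow> limsup (\<lambda>n. ereal (\<phi> n)) \<le> c"
| "asymp_cmp Ge \<phi> c \<longleftrightarrow> liminf (\<lambda>n. ereal (\<phi> n)) \<ge> c"

definition bounding_function ::
    "'a algorithm \<Rightarrow> 'a algorithm \<Rightarrow> direction \<Rightarrow> (nat \<Rightarrow> real) \<Rightarrow> bool" where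
  "bounding_function A B d f \<longleftrightarrow>
     rel_function A B d f \<and>
     (\<forall>g. rel_function A B d g \<longrightarrow> asymp_cmp d (\<lambda>n. f n / g n) 1)"

text \<open>The limit of a single bounding function has to exist, possibly as an infinite value.\<close>

definition lim_cmp :: "direction \<Rightarrow> (nat \<Rightarrow> real) \<Rightarrow> ereal \<Rightarrow> bool" where
  "lim_cmp d \<phi> c \<longleftrightarrow> (\<exists>l. (\<lambda>n. ereal (\<phi> n)) \<longlonglongrightarrow> l \<and> cmp d l c)"

definition relative_worst_order_function ::
    "'a algorithm \<Rightarrow> 'a algorithm \<Rightarrow> (nat \<Rightarrow> real) \<Rightarrow> bool" where
  "relative_worst_order_function A B \<phi> \<longleftrightarrow>
     (\<exists>f g. bounding_function A B Le f \<and> bounding_function A B Ge g \<and>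
        (lim_cmp Le f 1 \<and> \<phi> = g \<or> lim_cmp Ge g 1 \<and> \<phi> = f))"

definition equivalent :: "(nat \<Rightarrow> real) \<Rightarrow> (nat \<Rightarrow> real) \<Rightarrow> bool" where
  "equivalent f g \<longleftrightarrow> (\<lambda>n. f n / g n) \<longlonglongrightarrow> 1"

text \<open>\<open>WR A B\<close> is a class of functions, so that \<open>WR\<^bsub>A,B\<^esub> = f n\<close> is written \<open>f \<in> WR A B\<close>.\<close>

definition WR :: "'a algorithm \<Rightarrow> 'a algorithm \<Rightarrow> (nat \<Rightarrow> real) set" where
  "WR A B = {f. \<exists>\<phi>. relative_worst_order_function A B \<phi> \<and> equivalent f \<phi>}"

end

theory Submission
  imports Defs "HOL-Real_Asymp.Real_Asymp"
begin

text \<open>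
  The aggregate of \<open>nai\<close> does not depend on the order of the input. Every multiset can be ordered
  so that equal neighbours occur only inside a final constant block; on such an ordering \<open>eag\<close>
  agrees with \<open>nai\<close>, so in the worst order \<open>nai\<close> is at least as good as \<open>eag\<close>. Inputs without
  repeated items show that no better constant than 1 is possible there.

  In the other direction, the item held by \<open>eag\<close> at step \<open>t\<close> is the \<open>t\<close>-th input item or occurs at
  least twice, so step by step \<open>nai\<close> gains at most the factor \<open>n / 2 + 1\<close>. The inputs \<open>a a b \<dots> b\<close>
  give a ratio of at least \<open>(n - 4) / 2\<close>.
\<close>

section \<open>Frequencies as multiset counts\<close>

lemma count_mset_eq_card: "count (mset I) a = card {i. i < length I \<and> a = I ! i}"
  by (simp add: count_mset count_list_eq_length_filter length_filter_conv_card)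

lemma freq_eq_count: "freq I a = real (count (mset I) a) / real (length I)"
proof -
  have "{i \<in> {1..length I}. item I i = a} = Suc ` {i. i < length I \<and> a = I ! i}"
  proof (intro equalityI subsetI)
    fix i assume "i \<in> {i \<in> {1..length I}. item I i = a}"
    then show "i \<in> Suc ` {i. i < length I \<and> a = I ! i}"
      by (intro image_eqI[of _ _ "i - 1"]) (auto simp: item_def)
  qed (auto simp: item_def)
  then have "card {i \<in> {1..length I}. item I i = a} = card {i. i < length I \<and> a = I ! i}"
    by (simp add: card_image)
  then show ?thesis
    by (simp add: freq_def count_mset_eq_card)
qed

lemma item_in_set: "1 \<le> t \<Longrightarrow> t \<le> length I \<Longrightarrow> item I t \<in> set I"
  by (simp add: item_def)

lemma freq_ge_inverse:
  assumes "a \<in> set I"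
  shows "1 / real (length I) \<le> freq I a"
proof -
  have "1 \<le> count (mset I) a"
    using assms by (simp only: count_greater_eq_one_iff set_mset_mset)
  then show ?thesis
    unfolding freq_eq_count by (intro divide_right_mono) linarith+
qed

lemma freq_le_one: "freq I a \<le> 1"
  using count_le_length[of I a] by (simp add: freq_eq_count divide_le_eq_1 count_mset)

section \<open>Order invariance of \<open>nai\<close> and worst orders\<close>

lemma aggregate_nai: "aggregate nai I = sum_list (map (freq I) I)"
proof -
  have "aggregate nai I = (\<Sum>t = 1..length I. freq I (I ! (t - 1)))"
    by (simp add: aggregate_def nai_def item_def)
  also have "\<dots> = (\<Sum>i = 0..<length I. freq I (I ! i))"
    by (rule sum.reindex_bij_witness[of _ Suc "\<lambda>t. t - 1"]) auto
  also have "\<dots> = sum_list (map (freq I) I)"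
    by (simp add: sum_list_sum_nth)
  finally show ?thesis .
qed

text \<open>Both the summand \<open>freq I\<close> and the collection of items summed over depend
  only on the multiset of the input.\<close>

lemma aggregate_nai_perm:
  assumes "mset J = mset I"
  shows "aggregate nai J = aggregate nai I"
proof -
  have "freq J = freq I"
    using assms by (auto simp: fun_eq_iff freq_eq_count dest: mset_eq_length)
  then have "aggregate nai J = sum_mset (image_mset (freq I) (mset J))"
    by (simp add: aggregate_nai flip: sum_mset_sum_list)
  then show ?thesis
    by (simp add: assms aggregate_nai flip: sum_mset_sum_list)
qed

lemma worst_order_le: "mset J = mset I \<Longrightarrow> worst_order A I \<le> aggregate A J"
  unfolding worst_order_def
  by (intro Min_le finite_imageI finite_permutations_of_multiset imageI permutations_of_multisetI)

lemma worst_order_attained: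
  obtains J where "mset J = mset I" "worst_order A I = aggregate A J"
proof -
  have "worst_order A I \<in> aggregate A ` permutations_of_multiset (mset I)"
    unfolding worst_order_def by (intro Min_in) auto
  then show thesis
    using that by (auto simp: permutations_of_multiset_def)
qed

lemma worst_order_nai: "worst_order nai I = aggregate nai I"
  by (metis worst_order_attained aggregate_nai_perm)

section \<open>The stopping step of \<open>eag\<close> and the upper bound on the ratio\<close>

lemma eag_stop_cases:
  obtains "eag_stop I = length I"
  | "1 \<le> eag_stop I" "eag_stop I < length I" "item I (eag_stop I) = item I (eag_stop I + 1)"
proof -
  define T where "T = {t \<in> {1..<length I}. item I t = item I (t + 1)}"
  have "eag_stop I = (if T = {} then length I else Min T)"
    by (simp only: eag_stop_def T_def Let_def)
  moreover have "T \<noteq> {} \<Longrightarrow> Min T \<in> T"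
    by (rule Min_in) (auto simp: T_def)
  ultimately have "eag_stop I = length I \<or> eag_stop I \<in> T"
    by presburger
  then show thesis
    using that unfolding T_def by auto
qed

lemma eag_in_set: "1 \<le> t \<Longrightarrow> t \<le> length I \<Longrightarrow> eag I t \<in> set I"
  by (cases rule: eag_stop_cases[of I]) (auto simp: eag_def intro: item_in_set)

lemma eag_item_or_repeated:
  assumes "1 \<le> t" "t \<le> length I"
  shows "eag I t = item I t \<or> 2 \<le> count (mset I) (eag I t)"
proof (cases "t \<le> eag_stop I")
  case True
  then show ?thesis by (simp add: eag_def)
next
  case False
  define s where "s = eag_stop I"
  have s: "1 \<le> s" "s < length I" "item I s = item I (s + 1)"
    using False assms unfolding s_def by (cases rule: eag_stop_cases[of I]; simp)+
  \<comment> \<open>Steps \<open>s\<close> and \<open>s + 1\<close> sit at list positions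
    \<open>s - 1\<close> and \<open>s\<close>; these two positions witness the repetition.\<close>
  have "{s - 1, s} \<subseteq> {i. i < length I \<and> item I s = I ! i}"
    using s by (auto simp: item_def)
  then have "card {s - 1, s} \<le> count (mset I) (item I s)"
    unfolding count_mset_eq_card by (intro card_mono) auto
  then show ?thesis
    using False s by (simp add: eag_def s_def)
qed

text \<open>The buffer always holds an item of the input, so each of the n steps contributes at
  least 1/n.\<close>

lemma aggregate_eag_ge_one:
  assumes "I \<noteq> []"
  shows "1 \<le> aggregate eag I"
proof -
  have "(\<Sum>t = 1..length I. 1 / real (length I)) \<le> aggregate eag I"
    unfolding aggregate_def by (intro sum_mono freq_ge_inverse eag_in_set; simp)
  then show ?thesis
    using assms by simp
qed

lemma aggregate_nai_le_eag:
  "aggregate nai I \<le> (real (length I) / 2 + 1) * aggregate eag I"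
  unfolding aggregate_def sum_distrib_left
proof (rule sum_mono)
  fix t assume "t \<in> {1..length I}"
  then have t: "1 \<le> t" "t \<le> length I" by auto
  let ?n = "real (length I)"
  have n: "?n > 0" using t by linarith
  consider "eag I t = item I t" | "2 \<le> count (mset I) (eag I t)"
    using eag_item_or_repeated[OF t] by blast
  then show "freq I (nai I t) \<le> (?n / 2 + 1) * freq I (eag I t)"
  proof cases
    case 1
    have "1 * freq I (item I t) \<le> (?n / 2 + 1) * freq I (item I t)"
      by (intro mult_right_mono) (auto simp: freq_eq_count)
    then show ?thesis using 1 by (simp add: nai_def)
  next
    case 2
    \<comment> \<open>A repeated item has frequency at least 2/n, while no frequency exceeds 1 =
      (n/2) * (2/n).\<close>
    have "freq I (nai I t) \<le> (?n / 2) * (2 / ?n)"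
      using freq_le_one n by simp
    also have "\<dots> \<le> (?n / 2 + 1) * freq I (eag I t)"
      using 2 by (intro mult_mono) (auto simp: freq_eq_count divide_right_mono)
    finally show ?thesis .
  qed
qed

section \<open>Orderings on which \<open>eag\<close> agrees with \<open>nai\<close>\<close>

lemma spread_permutation_exists:
  assumes "M \<noteq> {#}"
  shows "\<exists>xs k a. mset (xs @ replicate (Suc k) a) = M \<and> distinct_adj (xs @ [a])"
  using assms
proof (induction M rule: multiset_induct)
  case empty
  then show ?case by simp
next
  case (add y M)
  show ?case
  proof (cases "M = {#}")
    case True
    then show ?thesis
      by (intro exI[of _ "[]"] exI[of _ 0] exI[of _ y]) simp
  next
    case False
    with add.IH obtain xs k a
      where M: "mset (xs @ replicate (Suc k) a) = M" and xs: "distinct_adj (xs @ [a])"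
      by blast
    \<comment> \<open>If \<open>y = a\<close>, the final block grows. Otherwise \<open>y\<close>
      either follows a block consisting of a single \<open>a\<close> and becomes the new block, or
      separates the first \<open>a\<close> of a longer block from the remaining ones.\<close>
    consider "y = a" | "y \<noteq> a" "k = 0" | k' where "y \<noteq> a" "k = Suc k'"
      by (cases k) auto
    then show ?thesis
    proof cases
      case 1
      then show ?thesis using M xs
        by (intro exI[of _ xs] exI[of _ "Suc k"] exI[of _ y]) auto
    next
      case 2
      then show ?thesis using M xs
        by (intro exI[of _ "xs @ [a]"] exI[of _ 0] exI[of _ y])
          (auto simp: distinct_adj_append_iff)
    next
      case 3
      then show ?thesis using M xs
        by (intro exI[of _ "xs @ [a, y]"] exI[of _ k'] exI[of _ a])
          (auto simp: distinct_adj_append_iff)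
    qed
  qed
qed

text \<open>Equal neighbours can only be found inside the final block, so a stopped
  \<open>eag\<close> holds \<open>a\<close>, and every later item is \<open>a\<close> as
  well.\<close>

lemma eag_eq_nai_on_spread:
  assumes xs: "distinct_adj (xs @ [a])" and I: "I = xs @ replicate (Suc k) a"
    and t: "1 \<le> t" "t \<le> length I"
  shows "eag I t = nai I t"
proof (cases "t \<le> eag_stop I")
  case True
  then show ?thesis by (simp add: eag_def nai_def)
next
  case False
  define s where "s = eag_stop I"
  have s: "1 \<le> s" "s < length I" "item I s = item I (s + 1)"
    using False t unfolding s_def by (cases rule: eag_stop_cases[of I]; simp)+
  \<comment> \<open>The block has at least one element, so \<open>xs @ [a]\<close> is a prefix of
    \<open>I\<close>.\<close>
  have nth: "I ! i = (xs @ [a]) ! i" if "i \<le> length xs" for i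
    using that by (auto simp: I nth_append)
  have const: "I ! i = a" if "length xs \<le> i" "i < length I" for i
    using that by (auto simp: I nth_append simp del: replicate.simps)
  have "length xs < s"
  proof (rule ccontr)
    assume "\<not> length xs < s"
    then have "(xs @ [a]) ! (s - 1) = (xs @ [a]) ! Suc (s - 1)" "Suc (s - 1) < length (xs @ [a])"
      using s nth[of "s - 1"] nth[of s] by (auto simp: item_def)
    then show False
      using xs unfolding distinct_adj_conv_nth by blast
  qed
  then have "item I s = a" "item I t = a"
    using False s t by (auto simp: item_def s_def intro!: const)
  then show ?thesis
    using False by (simp add: eag_def nai_def s_def)
qed

lemma worst_order_eag_le_nai:
  assumes "I \<noteq> []"
  shows "worst_order eag I \<le> worst_order nai I"
proof -
  obtain xs k a where J: "mset (xs @ replicate (Suc k) a) = mset I" "distinct_adj (xs @ [a])"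
    using spread_permutation_exists[of "mset I"] assms by auto
  let ?J = "xs @ replicate (Suc k) a"
  have "worst_order eag I \<le> aggregate eag ?J"
    using J by (intro worst_order_le)
  also have "\<dots> = aggregate nai ?J"
    unfolding aggregate_def
    by (intro sum.cong refl arg_cong2[of _ _ _ _ freq] eag_eq_nai_on_spread[OF J(2) refl]) auto
  also have "\<dots> = worst_order nai I"
    by (metis J(1) worst_order_nai aggregate_nai_perm)
  finally show ?thesis .
qed

text \<open>The stepwise bound is applied to an ordering that is worst for \<open>eag\<close>;
  \<open>nai\<close> has the same value on it as on every other ordering.\<close>

lemma worst_order_nai_le_eag:
  "worst_order nai I \<le> (real (length I) / 2 + 1) * worst_order eag I"
proof -
  obtain J where J: "mset J = mset I" "worst_order eag I = aggregate eag J"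
    by (rule worst_order_attained)
  have "worst_order nai I = aggregate nai J"
    by (metis J(1) worst_order_nai aggregate_nai_perm)
  also have "\<dots> \<le> (real (length I) / 2 + 1) * worst_order eag I"
    using aggregate_nai_le_eag[of J] mset_eq_length[OF J(1)] by (simp add: J(2))
  finally show ?thesis .
qed

lemma worst_order_eag_ge_one:
  assumes "I \<noteq> []"
  shows "1 \<le> worst_order eag I"
proof -
  obtain J where J: "mset J = mset I" "worst_order eag I = aggregate eag J"
    by (rule worst_order_attained)
  then show ?thesis
    using assms aggregate_eag_ge_one[of J] by (cases "J = []") auto
qed

section \<open>Extremal inputs\<close>

lemma worst_order_nai_distinct:
  assumes "distinct I" "I \<noteq> []"
  shows "worst_order nai I = 1"
proof -
  have "map (freq I) I = map (\<lambda>_. 1 / real (length I)) I"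
    using assms by (intro map_cong refl) (simp add: freq_eq_count distinct_count_atmost_1)
  then show ?thesis
    using assms by (simp only: worst_order_nai aggregate_nai) (simp add: sum_list_triv)
qed

lemma worst_order_pair_replicate:
  fixes a b :: 'a
  assumes "a \<noteq> b" and I: "I = a # a # replicate m b"
  shows "worst_order eag I \<le> 2" "real (length I) - 4 \<le> worst_order nai I"
proof -
  \<comment> \<open>The leading pair makes \<open>eag\<close> keep \<open>a\<close>, of frequency
    2/n, for all n steps.\<close>
  have "eag_stop I = 1"
    unfolding eag_stop_def Let_def
    by (subst if_not_P) (auto simp: I item_def intro!: Min_eqI)
  then have "eag I t = a" if "1 \<le> t" for t
    using that by (auto simp: eag_def item_def I)
  then have "aggregate eag I = (\<Sum>t = 1..length I. freq I a)"
    by (simp add: aggregate_def)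
  also have "\<dots> = 2"
    using \<open>a \<noteq> b\<close> by (simp add: freq_eq_count I field_simps)
  finally show "worst_order eag I \<le> 2"
    by (metis worst_order_le)
  have "worst_order nai I = 2 * freq I a + m * freq I b"
    by (simp add: worst_order_nai aggregate_nai I sum_list_replicate)
  also have "\<dots> = (4 + real m * real m) / (real m + 2)"
    using \<open>a \<noteq> b\<close> by (simp add: freq_eq_count I add_divide_distrib add.commute)
  \<comment> \<open>The quotient equals m - 2 + 8/(m + 2), and \<open>length I\<close> is m +
    2.\<close>
  also have "real (length I) - 4 \<le> \<dots>"
    by (simp add: I field_simps)
  finally show "real (length I) - 4 \<le> worst_order nai I" .
qed

section \<open>Bounding functions in both directions and the conclusion\<close>

lemma bounding_nai_eag_Le:
  assumes "infinite (UNIV :: 'a set)"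
  shows "bounding_function (nai :: 'a algorithm) eag Le (\<lambda>n. real n / 2)"
  unfolding bounding_function_def
proof (intro conjI allI impI)
  \<comment> \<open>The summand 1 in the factor n/2 + 1 serves as the error term
    \<open>h\<close>.\<close>
  have "(\<lambda>_. 1 :: real) \<in> o(\<lambda>n. real n / 2)"
    by (rule smalloI_tendsto) (real_asymp, auto intro: eventually_mono[OF eventually_gt_at_top[of 0]])
  then show "rel_function (nai :: 'a algorithm) eag Le (\<lambda>n. real n / 2)"
    unfolding rel_function_def using worst_order_nai_le_eag by auto
next
  fix g assume "rel_function (nai :: 'a algorithm) eag Le g"
  then obtain h where pos: "\<And>n. n \<ge> 1 \<Longrightarrow> g n > 0" and h: "h \<in> o(g)"
    and le: "\<And>I :: 'a list. I \<noteq> [] \<Longrightarrow>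
      worst_order nai I \<le> (g (length I) + h (length I)) * worst_order eag I"
    unfolding rel_function_def by auto
  obtain a b :: 'a where "a \<noteq> b"
    using assms by (metis (full_types) UNIV_eq_I finite.simps insertCI)
  define r where "r n = h n / g n" for n
  have r: "r \<longlonglongrightarrow> 0"
    using smalloD_tendsto[OF h] by (simp add: r_def[abs_def])
  \<comment> \<open>Solving n - 4 \<le> 2 * g(n) * (1 + r(n)) for n / (2 * g(n)) gives this bound,
    which tends to 1.\<close>
  let ?u = "\<lambda>n. (1 + r n) * (real n / (real n - 4))"
  \<comment> \<open>This makes \<open>g n + h n\<close> positive, so that multiplying by it
    preserves the bound 2 on the worst order of \<open>eag\<close>.\<close>
  have "eventually (\<lambda>n. r n > -1) sequentially"
    using r by (rule order_tendstoD) simp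
  with eventually_gt_at_top[of 4]
  have "eventually (\<lambda>n. ereal (real n / 2 / g n) \<le> ereal (?u n)) sequentially"
  proof eventually_elim
    case (elim n)
    define I where "I = a # a # replicate (n - 2) b"
    have n: "length I = n" using elim by (simp add: I_def)
    have g: "g n > 0" using pos elim by simp
    then have gh: "g n + h n = g n * (1 + r n)"
      by (simp add: r_def field_simps)
    have "real n - 4 \<le> (g n + h n) * worst_order eag I"
      using worst_order_pair_replicate(2)[OF \<open>a \<noteq> b\<close> I_def] le[of I] n by (simp add: I_def)
    also have "\<dots> \<le> (g n + h n) * 2"
      using worst_order_pair_replicate(1)[OF \<open>a \<noteq> b\<close> I_def] g elim
      by (intro mult_left_mono) (auto simp: gh)
    finally have "real n * (real n - 4) \<le> real n * (g n * (1 + r n) * 2)"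
      by (intro mult_left_mono) (auto simp: gh)
    then show ?case
      using g elim by (simp add: field_simps)
  qed
  then have "limsup (\<lambda>n. ereal (real n / 2 / g n)) \<le> limsup (\<lambda>n. ereal (?u n))"
    by (rule Limsup_mono)
  also have "?u \<longlonglongrightarrow> (1 + 0) * 1"
    by (intro tendsto_mult tendsto_add tendsto_const r) real_asymp
  then have "limsup (\<lambda>n. ereal (?u n)) = ereal 1"
    by (intro lim_imp_Limsup) auto
  finally show "asymp_cmp Le (\<lambda>n. real n / 2 / g n) 1"
    by (simp add: one_ereal_def)
qed

lemma bounding_nai_eag_Ge:
  assumes "infinite (UNIV :: 'a set)"
  shows "bounding_function (nai :: 'a algorithm) eag Ge (\<lambda>_. 1)"
  unfolding bounding_function_def
proof (intro conjI allI impI)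
  show "rel_function (nai :: 'a algorithm) eag Ge (\<lambda>_. 1)"
    unfolding rel_function_def
    by (intro conjI exI[of _ "\<lambda>_. 0"]) (auto intro: worst_order_eag_le_nai)
next
  fix g assume "rel_function (nai :: 'a algorithm) eag Ge g"
  then obtain h where pos: "\<And>n. n \<ge> 1 \<Longrightarrow> g n > 0" and h: "h \<in> o(g)"
    and ge: "\<And>I :: 'a list. I \<noteq> [] \<Longrightarrow>
      worst_order nai I \<ge> (g (length I) + h (length I)) * worst_order eag I"
    unfolding rel_function_def by auto
  define r where "r n = h n / g n" for n
  have r: "r \<longlonglongrightarrow> 0"
    using smalloD_tendsto[OF h] by (simp add: r_def[abs_def])
  have "eventually (\<lambda>n. r n > -1) sequentially"
    using r by (rule order_tendstoD) simp
  with eventually_gt_at_top[of 0]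
  have "eventually (\<lambda>n. ereal (1 + r n) \<le> ereal (1 / g n)) sequentially"
  proof eventually_elim
    case (elim n)
    \<comment> \<open>The infinite universe supplies n distinct items for every n. On them
      \<open>nai\<close> has value 1 and \<open>eag\<close> at least 1, which forces g(n) + h(n)
      \<le> 1.\<close>
    obtain A :: "'a set" where A: "finite A" "card A = n"
      using infinite_arbitrarily_large[OF assms] by blast
    then obtain I where "set I = A" "distinct I"
      using finite_distinct_list by blast
    then have I: "distinct I" "length I = n"
      using A distinct_card[of I] by simp_all
    then have "I \<noteq> []" using elim by auto
    have g: "g n > 0" using pos elim by simp
    then have gh: "g n + h n = g n * (1 + r n)"
      by (simp add: r_def field_simps)
    have "g n * (1 + r n) * 1 \<le> (g n + h n) * worst_order eag I"
      unfolding gh using worst_order_eag_ge_one[OF \<open>I \<noteq> []\<close>] g elim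
      by (intro mult_left_mono) auto
    also have "\<dots> \<le> 1"
      using ge[OF \<open>I \<noteq> []\<close>] worst_order_nai_distinct[OF I(1) \<open>I \<noteq> []\<close>] I by simp
    finally show ?case
      using g by (simp add: field_simps)
  qed
  then have "liminf (\<lambda>n. ereal (1 + r n)) \<le> liminf (\<lambda>n. ereal (1 / g n))"
    by (rule Liminf_mono)
  moreover have "(\<lambda>n. 1 + r n) \<longlonglongrightarrow> 1 + 0"
    by (intro tendsto_add tendsto_const r)
  then have "liminf (\<lambda>n. ereal (1 + r n)) = ereal 1"
    by (intro lim_imp_Liminf) auto
  ultimately show "asymp_cmp Ge (\<lambda>n. 1 / g n) 1"
    by (simp add: one_ereal_def)
qed

theorem theorem9:
  assumes "infinite (UNIV :: 'a set)"
  shows "(\<lambda>n. real n / 2) \<in> WR (nai :: 'a algorithm) (eag :: 'a algorithm)"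
proof -
  \<comment> \<open>The lower bounding function has limit 1, so \<open>nai\<close> is the better
    algorithm and the upper bounding function n/2 is the relative worst order function.\<close>
  have "lim_cmp Ge (\<lambda>_. 1) 1"
    unfolding lim_cmp_def by (intro exI[of _ 1]) (auto simp: one_ereal_def)
  then have "relative_worst_order_function (nai :: 'a algorithm) eag (\<lambda>n. real n / 2)"
    unfolding relative_worst_order_function_def
    using bounding_nai_eag_Le[OF assms] bounding_nai_eag_Ge[OF assms] by blast
  moreover have "equivalent (\<lambda>n. real n / 2) (\<lambda>n. real n / 2)"
    unfolding equivalent_def by real_asymp
  ultimately show ?thesis
    unfolding WR_def by blast
qed

end
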